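(* Let $(X,d)$ be a compact metric space and let $\mathbb{F}=\{f_n:n\in\mathbb{N}\}$ be a family of continuous surjective maps $f_n:X\to X$ that is commutative, i.e. $f_i\circ f_j=f_j\circ f_i$ for all $i,j\in\mathbb{N}$. Then $(X,\mathbb{F})$ is weakly mixing if and only if for any finite collection of non-empty open sets $\{U_1,U_2,\dots,U_m\}$ of $X$ there exists a subsequence $(r_n)$ of the positive integers such that $\lim_{n\to\infty}\omega_{r_n}(U_i)=X$ for all $i=1,2,\dots,m$.
   Context: $\mathbb{N}$ denotes the positive integers. $(X,\mathbb{F})$ is the non-autonomous system $x_n=f_n(x_{n-1})$, and $\omega_n=f_n\circ f_{n-1}\circ\cdots\circ f_1$. The family $\mathbb{F}$ is an arbitrary sequence of maps (repetitions allowed; in particular it may be a finite family repeated cyclically). The system is weakly mixing if for any non-empty open sets $U_1,U_2,V_1,V_2\subseteq X$ there exists $n\in\mathbb{N}$ such that $\omega_n(U_i)\cap V_i\neq\emptyset$ for $i=1,2$. A subsequence of the positive integers is a strictly increasing sequence of positive integers. Limits of sets are taken in the Hausdorff metric: for non-empty $A,B\subseteq X$, $d_H(A,B)=\inf\{\epsilon>0: A\subseteq S_\epsilon(B)\text{ and }B\subseteq S_\epsilon(A)\}$, where $S_\epsilon(A)=\{x\in X: d(x,a)<\epsilon\text{ for some }a\in A\}$; $\lim_{n\to\infty}A_n=X$ means $d_H(A_n,X)\to0$. *)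

theory Defs
  imports "HOL-Analysis.Analysis"
begin

(* The space X is the whole type; the maps are f 1, f 2, ..., and f 0 is never used. *)

primrec omega :: "(nat \<Rightarrow> 'a \<Rightarrow> 'a) \<Rightarrow> nat \<Rightarrow> 'a \<Rightarrow> 'a" where
  "omega f 0 = id"
| "omega f (Suc n) = f (Suc n) \<circ> omega f n"

definition weakly_mixing :: "(nat \<Rightarrow> 'a::topological_space \<Rightarrow> 'a) \<Rightarrow> bool" where
  "weakly_mixing f \<longleftrightarrow>
    (\<forall>U1 U2 V1 V2. open U1 \<and> U1 \<noteq> {} \<and> open U2 \<and> U2 \<noteq> {} \<and>
                   open V1 \<and> V1 \<noteq> {} \<and> open V2 \<and> V2 \<noteq> {} \<longrightarrow>
      (\<exists>n\<ge>1. omega f n ` U1 \<inter> V1 \<noteq> {} \<and> omega f n ` U2 \<inter> V2 \<noteq> {}))"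

definition nbhd :: "real \<Rightarrow> 'a::metric_space set \<Rightarrow> 'a set" where
  "nbhd \<epsilon> A = {x. \<exists>a\<in>A. dist x a < \<epsilon>}"

(* Inf is the real infimum, so this is meaningful only when the set of admissible \<epsilon>
   is non-empty, e.g. for non-empty subsets of a bounded space. *)
definition hausdorff_dist :: "'a::metric_space set \<Rightarrow> 'a set \<Rightarrow> real" where
  "hausdorff_dist A B = Inf {\<epsilon>. \<epsilon> > 0 \<and> A \<subseteq> nbhd \<epsilon> B \<and> B \<subseteq> nbhd \<epsilon> A}"

definition hausdorff_tendsto :: "(nat \<Rightarrow> 'a::metric_space set) \<Rightarrow> 'a set \<Rightarrow> bool" where
  "hausdorff_tendsto A B \<longleftrightarrow> (\<lambda>n. hausdorff_dist (A n) B) \<longlonglongrightarrow> 0"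

end

(* Call N(U,V) the set of n with omega_n(U) meeting V.  If n lies in both N(U1,U2) and N(V1,V2),
   then, since the omega_k commute, N(U,V) is contained in the intersection of N(U1,V1) and N(U2,V2),
   where U is the intersection of U1 with the omega_n-preimage of U2, and V that of V1 with the
   omega_n-preimage of V2 (Furstenberg's intersection lemma).  So finitely many sets N(U_i,V_i)
   always have a common element.  Unless X is a point, X has no isolated points, and shrinking U
   and V then removes any given finite set of times from N(U,V), so that common element can be
   taken arbitrarily large.  Applied to a finite cover by small balls, this makes the images of
   all the U_i dense up to a prescribed error at arbitrarily late times. *)
theory Submission
  imports Defs
begin

section \<open>Hitting times; continuity and commutation of the compositions\<close>

definition hitting_times :: "(nat \<Rightarrow> 'a \<Rightarrow> 'a) \<Rightarrow> 'a set \<Rightarrow> 'a set \<Rightarrow> nat set" where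
  "hitting_times f U V = {n. n \<ge> 1 \<and> omega f n ` U \<inter> V \<noteq> {}}"

lemma hitting_times_mono:
  "U' \<subseteq> U \<Longrightarrow> V' \<subseteq> V \<Longrightarrow> hitting_times f U' V' \<subseteq> hitting_times f U V"
  unfolding hitting_times_def by blast

lemma weakly_mixing_hitting_times:
  assumes "weakly_mixing f" "open U1" "U1 \<noteq> {}" "open U2" "U2 \<noteq> {}"
    and "open V1" "V1 \<noteq> {}" "open V2" "V2 \<noteq> {}"
  obtains n where "n \<in> hitting_times f U1 V1" "n \<in> hitting_times f U2 V2"
proof -
  obtain n where "n \<ge> 1" "omega f n ` U1 \<inter> V1 \<noteq> {}" "omega f n ` U2 \<inter> V2 \<noteq> {}"
    using assms(1)[unfolded weakly_mixing_def, rule_format, of U1 U2 V1 V2] assms(2-) by auto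
  then show ?thesis by (intro that[of n]) (simp_all add: hitting_times_def)
qed

lemma continuous_on_omega:
  assumes "\<And>n. n \<ge> 1 \<Longrightarrow> continuous_on UNIV (f n)"
  shows "continuous_on UNIV (omega f n)"
proof (induction n)
  case (Suc n)
  have "continuous_on (omega f n ` UNIV) (f (Suc n))"
    using assms[of "Suc n"] continuous_on_subset by auto
  with Suc show ?case by (simp add: continuous_on_compose del: o_apply)
qed (simp add: id_def)

lemma omega_commute_map:
  assumes "\<And>i j. i \<ge> 1 \<Longrightarrow> j \<ge> 1 \<Longrightarrow> f i \<circ> f j = f j \<circ> f i" and "i \<ge> 1"
  shows "omega f n (f i x) = f i (omega f n x)"
proof (induction n)
  case (Suc n)
  then show ?case using fun_cong[OF assms(1)[of i "Suc n"], of "omega f n x"] assms(2) by simp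
qed simp

lemma omega_commute:
  assumes "\<And>i j. i \<ge> 1 \<Longrightarrow> j \<ge> 1 \<Longrightarrow> f i \<circ> f j = f j \<circ> f i"
  shows "omega f n (omega f k x) = omega f k (omega f n x)"
proof (induction k)
  case (Suc k)
  then show ?case using omega_commute_map[of f "Suc k" n "omega f k x", OF assms] by simp
qed simp

section \<open>Furstenberg's intersection lemma\<close>

context
  fixes f :: "nat \<Rightarrow> 'a::metric_space \<Rightarrow> 'a"
  assumes mixing: "weakly_mixing f"
    and cont: "\<And>n. n \<ge> 1 \<Longrightarrow> continuous_on UNIV (f n)"
begin

lemma open_omega_vimage: "open V \<Longrightarrow> open (omega f n -` V)"
  using continuous_on_omega[of f n] cont by (simp add: open_vimage)

lemma hitting_times_intersection:
  assumes comm: "\<And>i j. i \<ge> 1 \<Longrightarrow> j \<ge> 1 \<Longrightarrow> f i \<circ> f j = f j \<circ> f i"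
    and "open U1" "U1 \<noteq> {}" "open U2" "U2 \<noteq> {}" "open V1" "V1 \<noteq> {}" "open V2" "V2 \<noteq> {}"
  obtains U V where "open U" "U \<noteq> {}" "open V" "V \<noteq> {}"
    "hitting_times f U V \<subseteq> hitting_times f U1 V1 \<inter> hitting_times f U2 V2"
proof -
  \<comment> \<open>The roles are crossed: weak mixing is applied to \<open>U1\<close>,
    \<open>V1\<close> as sources and \<open>U2\<close>, \<open>V2\<close> as targets, so that this
    \<open>n\<close> makes \<open>?U\<close> and \<open>?V\<close> below nonempty.\<close>
  obtain n where n: "n \<in> hitting_times f U1 U2" "n \<in> hitting_times f V1 V2"
    using weakly_mixing_hitting_times[OF mixing, of U1 V1 U2 V2] assms by blast
  let ?U = "U1 \<inter> omega f n -` U2" and ?V = "V1 \<inter> omega f n -` V2"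
  \<comment> \<open>If \<open>x\<close> witnesses \<open>k\<close> for \<open>?U\<close> and
    \<open>?V\<close>, then \<open>omega f n x\<close> witnesses it for \<open>U2\<close> and
    \<open>V2\<close>: commuting the maps turns its image under \<open>omega f k\<close> into
    \<open>omega f n (omega f k x)\<close>.\<close>
  have "k \<in> hitting_times f U2 V2" if "k \<in> hitting_times f ?U ?V" for k
  proof -
    from that obtain x where x: "k \<ge> 1" "omega f n x \<in> U2" "omega f n (omega f k x) \<in> V2"
      by (auto simp: hitting_times_def)
    then have "omega f k (omega f n x) \<in> V2" by (simp add: omega_commute[OF comm])
    with x show ?thesis by (auto simp: hitting_times_def)
  qed
  moreover have "hitting_times f ?U ?V \<subseteq> hitting_times f U1 V1" by (rule hitting_times_mono) auto
  moreover have "?U \<noteq> {}" "?V \<noteq> {}" using n by (auto simp: hitting_times_def)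
  ultimately show ?thesis
    using that[of ?U ?V] assms open_omega_vimage by (meson IntI open_Int subsetI subset_iff)
qed

text \<open>Weak mixing handles only two pairs at a time; folding the two-pair lemma over
  \<open>I\<close> reduces all constraints to the single pair \<open>U\<close>,
  \<open>V\<close>.\<close>

lemma hitting_times_finite_intersection:
  assumes comm: "\<And>i j. i \<ge> 1 \<Longrightarrow> j \<ge> 1 \<Longrightarrow> f i \<circ> f j = f j \<circ> f i"
    and "finite I" "\<And>i. i \<in> I \<Longrightarrow> open (A i) \<and> A i \<noteq> {} \<and> open (B i) \<and> B i \<noteq> {}"
  shows "\<exists>U V. open U \<and> U \<noteq> {} \<and> open V \<and> V \<noteq> {} \<and> (\<forall>i\<in>I. hitting_times f U V \<subseteq> hitting_times f (A i) (B i))"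
  using assms(2,3)
proof (induction I rule: finite_induct)
  case empty
  have "open (UNIV :: 'a set)" "(UNIV :: 'a set) \<noteq> {}" by auto
  then show ?case by blast
next
  case (insert i I)
  then obtain U V where UV: "open U" "U \<noteq> {}" "open V" "V \<noteq> {}"
    "\<forall>i\<in>I. hitting_times f U V \<subseteq> hitting_times f (A i) (B i)" by auto
  moreover have "open (A i)" "A i \<noteq> {}" "open (B i)" "B i \<noteq> {}" using insert.prems by auto
  ultimately obtain U' V' where "open U'" "U' \<noteq> {}" "open V'" "V' \<noteq> {}"
    "hitting_times f U' V' \<subseteq> hitting_times f U V \<inter> hitting_times f (A i) (B i)"
    using hitting_times_intersection[OF comm, of U "A i" V "B i"] by blast
  with UV show ?case by (intro exI[of _ U'] exI[of _ V']) auto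
qed

section \<open>Arbitrarily late hitting times and nearly dense images\<close>

lemma weakly_mixing_not_singleton_open:
  fixes a b :: 'a
  assumes "a \<noteq> b" shows "\<not> open {x :: 'a}"
proof
  assume op: "open {x}"
  \<comment> \<open>With \<open>{x}\<close> as both sources, weak mixing would place the single
    point \<open>omega f n x\<close> in two disjoint sets.\<close>
  obtain A B where "open A" "open B" "a \<in> A" "b \<in> B" "A \<inter> B = {}" using hausdorff[OF assms] by blast
  then obtain n where "n \<in> hitting_times f {x} A" "n \<in> hitting_times f {x} B"
    using weakly_mixing_hitting_times[OF mixing op _ op, of A B] by blast
  with \<open>A \<inter> B = {}\<close> show False by (auto simp: hitting_times_def)
qed

text \<open>Since \<open>V\<close> is not a single point, it contains some \<open>v\<close>
  different from \<open>omega f n u\<close>. Separating these two points and pulling one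
  neighbourhood back by continuity gives the smaller sets.\<close>

lemma shrink_avoiding_time:
  fixes a b :: 'a
  assumes "a \<noteq> b" "open U" "U \<noteq> {}" "open V" "V \<noteq> {}"
  obtains U' V' where "open U'" "U' \<noteq> {}" "open V'" "V' \<noteq> {}" "U' \<subseteq> U" "V' \<subseteq> V" "n \<notin> hitting_times f U' V'"
proof -
  obtain u where u: "u \<in> U" using assms by blast
  have "V \<noteq> {omega f n u}" using weakly_mixing_not_singleton_open[OF \<open>a \<noteq> b\<close>] \<open>open V\<close> by blast
  then obtain v where v: "v \<in> V" "omega f n u \<noteq> v" using assms by blast
  obtain A B where AB: "open A" "open B" "omega f n u \<in> A" "v \<in> B" "A \<inter> B = {}"
    using hausdorff[OF v(2)] by blast
  show ?thesis
    by (rule that[of "U \<inter> omega f n -` A" "V \<inter> B"])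
      (use u v AB assms open_omega_vimage in \<open>auto simp: hitting_times_def\<close>)
qed

text \<open>Times are removed one by one; by monotonicity, a time once removed stays removed under
  further shrinking.\<close>

lemma shrink_avoiding_times:
  fixes a b :: 'a
  assumes "a \<noteq> b" "open U" "U \<noteq> {}" "open V" "V \<noteq> {}"
  shows "\<exists>U' V'. open U' \<and> U' \<noteq> {} \<and> open V' \<and> V' \<noteq> {} \<and> U' \<subseteq> U \<and> V' \<subseteq> V \<and> (\<forall>n<K. n \<notin> hitting_times f U' V')"
proof (induction K)
  case 0
  show ?case using assms by auto
next
  case (Suc K)
  then obtain U' V' where *: "open U'" "U' \<noteq> {}" "open V'" "V' \<noteq> {}" "U' \<subseteq> U" "V' \<subseteq> V"
    "\<forall>n<K. n \<notin> hitting_times f U' V'" by blast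
  obtain U'' V'' where **: "open U''" "U'' \<noteq> {}" "open V''" "V'' \<noteq> {}" "U'' \<subseteq> U'" "V'' \<subseteq> V'"
    "K \<notin> hitting_times f U'' V''"
    using shrink_avoiding_time[OF assms(1) *(1-4)] by blast
  have "\<forall>n<Suc K. n \<notin> hitting_times f U'' V''"
    using * ** hitting_times_mono[of U'' U' V'' V' f] by (auto simp: less_Suc_eq)
  with * ** show ?case by (intro exI[of _ U''] exI[of _ V'']) auto
qed

lemma hitting_times_unbounded:
  assumes "open U" "U \<noteq> {}" "open V" "V \<noteq> {}"
  shows "\<exists>n\<ge>K. n \<in> hitting_times f U V"
proof (cases "\<exists>a b :: 'a. a \<noteq> b")
  case True
  then obtain U' V' where *: "open U'" "U' \<noteq> {}" "open V'" "V' \<noteq> {}" "U' \<subseteq> U" "V' \<subseteq> V"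
    "\<forall>n<K. n \<notin> hitting_times f U' V'" using shrink_avoiding_times[OF _ assms] by metis
  then obtain n where "n \<in> hitting_times f U' V'"
    using weakly_mixing_hitting_times[OF mixing, of U' U' V' V'] by blast
  with * hitting_times_mono[of U' U V' V f] show ?thesis by (meson not_le subsetD)
next
  case False
  \<comment> \<open>On a one-point space every positive time hits; \<open>Suc K\<close> is positive
    even for \<open>K = 0\<close>.\<close>
  then have "omega f (Suc K) ` U \<inter> V \<noteq> {}" using assms by (metis all_not_in_conv disjoint_iff imageI)
  then show ?thesis by (intro exI[of _ "Suc K"]) (auto simp: hitting_times_def)
qed

lemma weakly_mixing_images_dense:
  assumes comm: "\<And>i j. i \<ge> 1 \<Longrightarrow> j \<ge> 1 \<Longrightarrow> f i \<circ> f j = f j \<circ> f i"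
    and compact: "compact (UNIV :: 'a set)"
    and "finite I" "\<And>i. i \<in> I \<Longrightarrow> open (U i) \<and> U i \<noteq> {}" and "\<epsilon> > 0"
  shows "\<exists>n\<ge>K. n \<ge> 1 \<and> (\<forall>i\<in>I. UNIV \<subseteq> nbhd \<epsilon> (omega f n ` U i))"
proof -
  \<comment> \<open>Radius \<epsilon>/2, so that any two points of one ball are less than \<epsilon>
    apart.\<close>
  obtain C where C: "finite C" "UNIV \<subseteq> (\<Union>c\<in>C. ball (c :: 'a) (\<epsilon>/2))"
    using compact_eq_totally_bounded[of "UNIV :: 'a set"] compact \<open>\<epsilon> > 0\<close> by (meson half_gt_zero)
  \<comment> \<open>One constraint for each set and each ball: a hitting time of the pair
    \<open>W\<close>, \<open>V\<close> sends every \<open>U i\<close> into contact with every ball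
    of the cover.\<close>
  have "\<exists>W V. open W \<and> W \<noteq> {} \<and> open V \<and> V \<noteq> {} \<and>
      (\<forall>p\<in>I \<times> C. hitting_times f W V \<subseteq> hitting_times f (U (fst p)) (ball (snd p) (\<epsilon>/2)))"
    by (rule hitting_times_finite_intersection[OF comm]) (use assms C in auto)
  then obtain n where n: "n \<ge> K" "\<And>i c. i \<in> I \<Longrightarrow> c \<in> C \<Longrightarrow> n \<in> hitting_times f (U i) (ball c (\<epsilon>/2))"
    "n \<ge> 1"
    using hitting_times_unbounded[of _ _ K]
    by (smt (verit) SigmaI fst_conv hitting_times_def mem_Collect_eq snd_conv subsetD)
  have "x \<in> nbhd \<epsilon> (omega f n ` U i)" if "i \<in> I" for i x
  proof -
    obtain c where c: "c \<in> C" "dist c x < \<epsilon>/2"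
      using subsetD[OF C(2) UNIV_I[of x]] by auto
    with n(2)[OF that] obtain y where "y \<in> omega f n ` U i" "dist c y < \<epsilon>/2"
      unfolding hitting_times_def by fastforce
    moreover from this c have "dist x y < \<epsilon>" by (metis dist_triangle_half_r)
    ultimately show ?thesis unfolding nbhd_def by blast
  qed
  with n show ?thesis by blast
qed

end

section \<open>Hausdorff distance to the whole space\<close>

lemma nbhd_UNIV: "\<epsilon> > 0 \<Longrightarrow> nbhd \<epsilon> UNIV = UNIV"
  unfolding nbhd_def by (auto simp: set_eq_iff) (metis dist_self)

text \<open>The inclusion of \<open>A\<close> in a neighbourhood of the whole space is automatic, so
  \<epsilon> is itself an admissible radius. This also makes the infimum range over a nonempty set,
  which the lower bound 0 relies on.\<close>

lemma hausdorff_dist_UNIV: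
  assumes "\<epsilon> > 0" "UNIV \<subseteq> nbhd \<epsilon> A"
  shows "0 \<le> hausdorff_dist A UNIV" "hausdorff_dist A UNIV \<le> \<epsilon>"
proof -
  let ?E = "{\<epsilon>. \<epsilon> > 0 \<and> A \<subseteq> nbhd \<epsilon> UNIV \<and> UNIV \<subseteq> nbhd \<epsilon> A}"
  have "\<epsilon> \<in> ?E" using assms by (simp add: nbhd_UNIV)
  moreover have "bdd_below ?E" by (rule bdd_belowI[of _ 0]) auto
  ultimately show "hausdorff_dist A UNIV \<le> \<epsilon>" unfolding hausdorff_dist_def by (rule cInf_lower)
  from \<open>\<epsilon> \<in> ?E\<close> show "0 \<le> hausdorff_dist A UNIV"
    unfolding hausdorff_dist_def by (intro cInf_greatest) auto
qed

text \<open>Boundedness and \<open>A \<noteq> {}\<close> supply an admissible radius, so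
  \<open>Inf\<close> is a genuine infimum and some admissible radius lies strictly below
  \<open>e\<close>.\<close>

lemma nbhd_of_hausdorff_dist_less:
  fixes A :: "'a::metric_space set"
  assumes "bounded (UNIV :: 'a set)" "A \<noteq> {}" "hausdorff_dist A UNIV < e"
  shows "UNIV \<subseteq> nbhd e A"
proof -
  let ?E = "{\<epsilon>. \<epsilon> > 0 \<and> A \<subseteq> nbhd \<epsilon> UNIV \<and> UNIV \<subseteq> nbhd \<epsilon> A}"
  obtain a where "a \<in> A" using assms by blast
  obtain D where D: "\<And>x :: 'a. dist a x \<le> D" using assms(1) bounded_any_center[of UNIV a] by auto
  have "0 \<le> D" using D[of a] by simp
  moreover have "dist x a < D + 1" for x using D[of x] by (simp add: dist_commute)
  \<comment> \<open>Adding 1 makes the radius positive and the distance bound strict, even when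
    \<open>D = 0\<close>.\<close>
  ultimately have "D + 1 \<in> ?E" using \<open>a \<in> A\<close> by (auto simp: nbhd_UNIV) (auto simp: nbhd_def)
  then have "?E \<noteq> {}" by blast
  from cInf_lessD[OF this assms(3)[unfolded hausdorff_dist_def]]
  obtain \<epsilon> where "\<epsilon> < e" "UNIV \<subseteq> nbhd \<epsilon> A" by blast
  moreover have "nbhd \<epsilon> A \<subseteq> nbhd e A"
    using \<open>\<epsilon> < e\<close> unfolding nbhd_def by (auto intro: less_trans)
  ultimately show ?thesis by blast
qed

lemma hausdorff_tendsto_UNIV:
  assumes "\<And>n. UNIV \<subseteq> nbhd (inverse (real (Suc n))) (A n)"
  shows "hausdorff_tendsto A UNIV"
  unfolding hausdorff_tendsto_def
  by (rule tendsto_sandwich[OF _ _ tendsto_const LIMSEQ_inverse_real_of_nat])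
    (simp_all add: hausdorff_dist_UNIV[OF _ assms] del: of_nat_Suc)

text \<open>\<open>V\<close> contains a ball of some radius \<open>e\<close> about a point
  \<open>v\<close>; once the distance drops below \<open>e\<close>, some point of \<open>A n\<close>
  lies in that ball.\<close>

lemma hausdorff_tendsto_UNIV_meets_open:
  fixes A :: "nat \<Rightarrow> 'a::metric_space set"
  assumes "bounded (UNIV :: 'a set)" "\<And>n. A n \<noteq> {}" "hausdorff_tendsto A UNIV" "open V" "V \<noteq> {}"
  shows "\<forall>\<^sub>F n in sequentially. A n \<inter> V \<noteq> {}"
proof -
  obtain v e where v: "v \<in> V" "e > 0" "ball v e \<subseteq> V"
    using assms(4,5) by (meson all_not_in_conv openE)
  from assms(3) \<open>e > 0\<close> have "\<forall>\<^sub>F n in sequentially. hausdorff_dist (A n) UNIV < e"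
    unfolding hausdorff_tendsto_def by (rule order_tendstoD)
  then show ?thesis
  proof eventually_elim
    case (elim n)
    then have "v \<in> nbhd e (A n)" using nbhd_of_hausdorff_dist_less[OF assms(1,2)] by blast
    then obtain y where "y \<in> A n" "y \<in> ball v e" unfolding nbhd_def by auto
    with v(3) show ?case by blast
  qed
qed

section \<open>Weak mixing as Hausdorff convergence of images\<close>

theorem lemma5:
  fixes f :: "nat \<Rightarrow> 'a::metric_space \<Rightarrow> 'a"
  assumes "compact (UNIV :: 'a set)"
    and "\<And>n. n \<ge> 1 \<Longrightarrow> continuous_on UNIV (f n)"
    and "\<And>n. n \<ge> 1 \<Longrightarrow> surj (f n)"
    and "\<And>i j. i \<ge> 1 \<Longrightarrow> j \<ge> 1 \<Longrightarrow> f i \<circ> f j = f j \<circ> f i"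
  shows "weakly_mixing f \<longleftrightarrow>
    (\<forall>m\<ge>1. \<forall>U :: nat \<Rightarrow> 'a set. (\<forall>i\<in>{1..m}. open (U i) \<and> U i \<noteq> {}) \<longrightarrow>
      (\<exists>r :: nat \<Rightarrow> nat. strict_mono r \<and> (\<forall>n. r n \<ge> 1) \<and>
        (\<forall>i\<in>{1..m}. hausdorff_tendsto (\<lambda>n. omega f (r n) ` U i) UNIV)))"
  (is "?L \<longleftrightarrow> ?R")
proof
  assume mixing: ?L
  show ?R
  proof (intro allI impI)
    fix m :: nat and U :: "nat \<Rightarrow> 'a set"
    assume U: "\<forall>i\<in>{1..m}. open (U i) \<and> U i \<noteq> {}"
    let ?P = "\<lambda>k n. n \<ge> 1 \<and> (\<forall>i\<in>{1..m}. UNIV \<subseteq> nbhd (inverse (real (Suc k))) (omega f n ` U i))"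
    have dense: "\<exists>n\<ge>K. ?P k n" for K k
      using U by (intro weakly_mixing_images_dense[OF mixing assms(2,4,1)]) auto
    \<comment> \<open>Tolerances 1/(k+1) shrink to 0 while the times increase: \<open>dense\<close>
      offers a time for the next tolerance beyond the one just chosen.\<close>
    have "\<exists>r. \<forall>k. ?P k (r k) \<and> r k < r (Suc k)"
    proof (rule dependent_nat_choice)
      show "\<exists>n. ?P 0 n" using dense[of 0 0] by blast
      show "\<exists>n'. ?P (Suc k) n' \<and> n < n'" for n k using dense[of "Suc n" "Suc k"] by (auto simp: Suc_le_eq)
    qed
    then obtain r where r: "\<And>k. ?P k (r k)" "\<And>k. r k < r (Suc k)" by blast
    show "\<exists>r :: nat \<Rightarrow> nat. strict_mono r \<and> (\<forall>n. r n \<ge> 1) \<and>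
        (\<forall>i\<in>{1..m}. hausdorff_tendsto (\<lambda>n. omega f (r n) ` U i) UNIV)"
    proof (intro exI[of _ r] conjI ballI)
      show "strict_mono r" using r(2) by (simp add: strict_mono_Suc_iff)
      show "\<forall>n. r n \<ge> 1" using r(1) by blast
      show "hausdorff_tendsto (\<lambda>n. omega f (r n) ` U i) UNIV" if "i \<in> {1..m}" for i
        using r(1) that by (intro hausdorff_tendsto_UNIV) blast
    qed
  qed
next
  assume R: ?R
  show ?L
    unfolding weakly_mixing_def
  proof (intro allI impI, elim conjE)
    fix U1 U2 V1 V2 :: "'a set"
    assume open_sets: "open U1" "U1 \<noteq> {}" "open U2" "U2 \<noteq> {}" "open V1" "V1 \<noteq> {}" "open V2" "V2 \<noteq> {}"
    \<comment> \<open>The case \<open>m = 2\<close>; only the indices 1 and 2 matter. The targets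
      \<open>V1\<close>, \<open>V2\<close> do not enter the choice of \<open>r\<close>, since images
      converging to the whole space eventually meet every nonempty open set.\<close>
    let ?U = "\<lambda>i :: nat. if i = 1 then U1 else U2"
    obtain r where r: "\<And>n. r n \<ge> 1"
      "\<forall>i\<in>{1..2}. hausdorff_tendsto (\<lambda>n. omega f (r n) ` ?U i) UNIV"
    proof -
      have "\<forall>i\<in>{1..2}. open (?U i) \<and> ?U i \<noteq> {}" using open_sets by simp
      with R have "\<exists>r. strict_mono r \<and> (\<forall>n. r n \<ge> 1) \<and>
          (\<forall>i\<in>{1..2}. hausdorff_tendsto (\<lambda>n. omega f (r n) ` ?U i) UNIV)"
        by (elim allE[of _ 2] allE[of _ ?U]) simp
      then show ?thesis using that by blast
    qed
    have tendsto: "hausdorff_tendsto (\<lambda>n. omega f (r n) ` U1) UNIV" "hausdorff_tendsto (\<lambda>n. omega f (r n) ` U2) UNIV"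
      using bspec[OF r(2), of 1] bspec[OF r(2), of 2] by auto
    have "bounded (UNIV :: 'a set)" using assms(1) by (rule compact_imp_bounded)
    with tendsto open_sets have
      "\<forall>\<^sub>F n in sequentially. omega f (r n) ` U1 \<inter> V1 \<noteq> {}"
      "\<forall>\<^sub>F n in sequentially. omega f (r n) ` U2 \<inter> V2 \<noteq> {}"
      by (auto intro!: hausdorff_tendsto_UNIV_meets_open)
    \<comment> \<open>Both conditions hold from some index on, which yields one common time
      \<open>r n\<close>.\<close>
    then have "\<forall>\<^sub>F n in sequentially. omega f (r n) ` U1 \<inter> V1 \<noteq> {} \<and> omega f (r n) ` U2 \<inter> V2 \<noteq> {}"
      by (rule eventually_conj)
    then obtain n where "omega f (r n) ` U1 \<inter> V1 \<noteq> {} \<and> omega f (r n) ` U2 \<inter> V2 \<noteq> {}"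
      using eventually_happens' sequentially_bot by blast
    with r(1) show "\<exists>n\<ge>1. omega f n ` U1 \<inter> V1 \<noteq> {} \<and> omega f n ` U2 \<inter> V2 \<noteq> {}" by blast
  qed
qed

end
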